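(* Let $X$ be a Banach space and let $p\in[1,2]$. Then $X$ has Rademacher type $p$ if and only if $X$ (with the metric induced by its norm) has scaled Enflo type $p$. More precisely, $$\frac{1}{2\pi}\,T_p(X)\le \tau_p(X)\le 5\,T_p(X),$$ where $T_p(X)$ is the Rademacher type $p$ constant of $X$ and $\tau_p(X)$ is the scaled Enflo type $p$ constant of $X$.
   Context: Throughout, $\mathbb{E}_\varepsilon$ denotes expectation with respect to $\varepsilon=(\varepsilon_1,\dots,\varepsilon_n)$ chosen uniformly from $\{-1,1\}^n$. Rademacher type: for $p>0$, a Banach space $X$ has Rademacher type $p$ if there exists a constant $T<\infty$ such that for every $n\in\mathbb{N}$ and every $x_1,\dots,x_n\in X$, $$\mathbb{E}_\varepsilon\Big\|\sum_{j=1}^n\varepsilon_jx_j\Big\|_X^p\le T^p\sum_{j=1}^n\|x_j\|_X^p.$$ $T_p(X)$ denotes the infimum of all constants $T$ for which this holds ($T_p(X)=\infty$ if there is none). Scaled Enflo type: for $p>0$, a metric space $(\mathcal{M},d_{\mathcal{M}})$ has scaled Enflo type $p$ with constant $\tau$ (where $\tau<\infty$) if for every positive integer $n$ there exists an even positive integer $m$ such that for every $f:\mathbb{Z}_m^n\to\mathcal{M}$, $$\mathbb{E}_\varepsilon\int_{\mathbb{Z}_m^n}d_{\mathcal{M}}\Big(f\big(x+\tfrac m2\varepsilon\big),f(x)\Big)^p\,d\mu(x)\le\tau^pm^p\sum_{j=1}^n\int_{\mathbb{Z}_m^n}d_{\mathcal{M}}\big(f(x+e_j),f(x)\big)^p\,d\mu(x).$$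 Here $\mathbb{Z}_m=\mathbb{Z}/m\mathbb{Z}$, $\mu$ is the uniform probability measure on $\mathbb{Z}_m^n$, $\{e_j\}_{j=1}^n$ is the standard basis, and addition is coordinatewise modulo $m$. $\mathcal{M}$ has scaled Enflo type $p$ if it has it with some constant $\tau<\infty$. $\tau_p(\mathcal{M})$ denotes the infimum of all constants $\tau$ such that $\mathcal{M}$ has scaled Enflo type $p$ with constant $\tau$ ($\tau_p(\mathcal{M})=\infty$ if there is none). *)

theory Defs
  imports "HOL-Probability.Probability"
begin

abbreviation uniform_expectation :: "'b set \<Rightarrow> ('b \<Rightarrow> real) \<Rightarrow> real" where
  "uniform_expectation S g \<equiv> measure_pmf.expectation (pmf_of_set S) g"

definition sign_cube :: "nat \<Rightarrow> (nat \<Rightarrow> int) set" where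
  "sign_cube n = {1..n} \<rightarrow>\<^sub>E {-1, 1}"

text \<open>Elements of \<open>\<int>\<^sub>m\<^sup>n\<close> are extensional functions on \<open>{1..n}\<close> whose values are the
  least nonnegative representatives modulo \<open>m\<close>.\<close>

definition torus :: "nat \<Rightarrow> nat \<Rightarrow> (nat \<Rightarrow> int) set" where
  "torus m n = {1..n} \<rightarrow>\<^sub>E {0..<int m}"

definition torus_add :: "nat \<Rightarrow> nat \<Rightarrow> (nat \<Rightarrow> int) \<Rightarrow> (nat \<Rightarrow> int) \<Rightarrow> (nat \<Rightarrow> int)" where
  "torus_add m n x y = (\<lambda>i\<in>{1..n}. (x i + y i) mod int m)"

definition std_basis :: "nat \<Rightarrow> nat \<Rightarrow> int" where
  "std_basis j = (\<lambda>i. if i = j then 1 else 0)"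

text \<open>The constants below range over \<open>[0, \<infinity>)\<close>; nonnegativity has to be stated because
  \<open>powr\<close> is not the usual power at negative arguments. Exponents \<open>p\<close> are meant to be
  positive.\<close>

definition rademacher_type_with ::
    "'a::banach itself \<Rightarrow> real \<Rightarrow> real \<Rightarrow> bool" where
  "rademacher_type_with X p T \<longleftrightarrow> 0 \<le> T \<and>
     (\<forall>(n::nat) (x :: nat \<Rightarrow> 'a).
        uniform_expectation (sign_cube n)
          (\<lambda>\<epsilon>. norm (\<Sum>j=1..n. real_of_int (\<epsilon> j) *\<^sub>R x j) powr p)
        \<le> T powr p * (\<Sum>j=1..n. norm (x j) powr p))"

definition rademacher_type :: "'a::banach itself \<Rightarrow> real \<Rightarrow> bool" where
  "rademacher_type X p \<longleftrightarrow> (\<exists>T. rademacher_type_with X p T)"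

definition rademacher_type_const :: "'a::banach itself \<Rightarrow> real \<Rightarrow> ereal" where
  "rademacher_type_const X p = (INF T\<in>{T. rademacher_type_with X p T}. ereal T)"

definition scaled_enflo_type_with ::
    "'a::metric_space itself \<Rightarrow> real \<Rightarrow> real \<Rightarrow> bool" where
  "scaled_enflo_type_with M p \<tau> \<longleftrightarrow> 0 \<le> \<tau> \<and>
     (\<forall>n::nat. n > 0 \<longrightarrow>
       (\<exists>m::nat. m > 0 \<and> even m \<and>
         (\<forall>f :: (nat \<Rightarrow> int) \<Rightarrow> 'a.
            uniform_expectation (sign_cube n) (\<lambda>\<epsilon>.
              uniform_expectation (torus m n) (\<lambda>x.
                dist (f (torus_add m n x (\<lambda>i. int (m div 2) * \<epsilon> i))) (f x) powr p))
            \<le> \<tau> powr p * real m powr p *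
               (\<Sum>j=1..n. uniform_expectation (torus m n) (\<lambda>x.
                  dist (f (torus_add m n x (std_basis j))) (f x) powr p)))))"

definition scaled_enflo_type :: "'a::metric_space itself \<Rightarrow> real \<Rightarrow> bool" where
  "scaled_enflo_type M p \<longleftrightarrow> (\<exists>\<tau>. scaled_enflo_type_with M p \<tau>)"

definition scaled_enflo_type_const :: "'a::metric_space itself \<Rightarrow> real \<Rightarrow> ereal" where
  "scaled_enflo_type_const M p = (INF \<tau>\<in>{\<tau>. scaled_enflo_type_with M p \<tau>}. ereal \<tau>)"

end

(* Rademacher type gives scaled Enflo type: extend f periodically to F on the integer lattice and let g be
   its average over boxes of side k = 4n^2; take m = 2nk. Joining points by lattice paths, g is within
   a multiple nk = m/2 of the edge differences of F, so F may be replaced by g. The diagonal increment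
   g(x + (m/2)e) - g(x) is a sum of m/2 increments g(y + e) - g(y), and each of them is a Rademacher sum
   of averaged edge differences up to the effect of shifting a box by at most 1, which is negligible for
   boxes of that size. Only the convexity of t^p is used, with factor 3 instead of 5.

   Scaled Enflo type gives Rademacher type: test the inequality on f(x) = sum_j a(x_j) v_j, where a is a
   triangle wave of period m with slopes 1 and -1. Since a changes sign under x -> x + m/2, the left side
   is 2^p times the mean of |f|^p, the random signs can be introduced for free, and Jensen's inequality
   replaces |a(x_j)| by its mean, which is at least m/12. This gives the factor 6, which is less than 2 pi. *)

theory Submission
  imports Defs "HOL-Library.Function_Algebras"
begin

section \<open>Sums of \<open>p\<close>-th powers\<close>

text \<open>Jensen's inequality for t^p, applied to the mean of the terms. Convexity is taken on the
  open half-line \<open>{0<..}\<close>, so zero terms are discarded first; passing back from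
  \<open>card J\<close> to \<open>card I\<close> only increases the bound, because p - 1 >=
  0.\<close>

lemma powr_sum_le:
  fixes a :: "'b \<Rightarrow> real"
  assumes fin: "finite I" and p: "1 \<le> p" and nn: "\<And>i. i \<in> I \<Longrightarrow> 0 \<le> a i"
  shows "(\<Sum>i\<in>I. a i) powr p \<le> real (card I) powr (p - 1) * (\<Sum>i\<in>I. a i powr p)"
proof -
  define J where "J = {i \<in> I. 0 < a i}"
  have finJ: "finite J" and JI: "J \<subseteq> I" using fin by (auto simp: J_def)
  have sumJ: "(\<Sum>i\<in>I. a i) = (\<Sum>i\<in>J. a i)"
    using nn by (intro sum.mono_neutral_right fin JI) (auto simp: J_def order_class.less_le)
  have sumJp: "(\<Sum>i\<in>I. a i powr p) = (\<Sum>i\<in>J. a i powr p)"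
    using nn by (intro sum.mono_neutral_right fin JI) (auto simp: J_def order_class.less_le)
  show ?thesis
  proof (cases "J = {}")
    case True
    then show ?thesis by (simp add: sumJ sumJp)
  next
    case False
    define N where "N = real (card J)"
    have N: "0 < N" using False finJ by (simp add: N_def card_gt_0_iff)
    have "(\<Sum>i\<in>J. (1 / N) *\<^sub>R a i) powr p \<le> (\<Sum>i\<in>J. (1 / N) * a i powr p)"
      using powr_convex[OF p] finJ False N
      by (intro convex_on_sum[where C = "{0<..}"]) (auto simp: J_def N_def)
    then have le: "((\<Sum>i\<in>J. a i) / N) powr p \<le> (\<Sum>i\<in>J. a i powr p) / N"
      by (simp add: sum_divide_distrib)
    have "(\<Sum>i\<in>J. a i) powr p = N powr p * ((\<Sum>i\<in>J. a i) / N) powr p"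
      using N by (subst powr_mult[symmetric]) (auto simp: sum_nonneg J_def less_imp_le)
    also have "\<dots> \<le> N powr p * ((\<Sum>i\<in>J. a i powr p) / N)"
      by (intro mult_left_mono le) auto
    also have "\<dots> = N powr (p - 1) * (\<Sum>i\<in>J. a i powr p)"
      using N by (simp add: powr_diff)
    also have "\<dots> \<le> real (card I) powr (p - 1) * (\<Sum>i\<in>J. a i powr p)"
      using N p card_mono[OF fin JI]
      by (intro mult_right_mono powr_mono2 sum_nonneg) (auto simp: N_def)
    finally show ?thesis by (simp add: sumJ sumJp)
  qed
qed

lemma norm_sum_powr_le:
  fixes v :: "'b \<Rightarrow> 'a::real_normed_vector"
  assumes fin: "finite I" and p: "1 \<le> p"
  shows "norm (\<Sum>i\<in>I. v i) powr p \<le> real (card I) powr (p - 1) * (\<Sum>i\<in>I. norm (v i) powr p)"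
proof -
  have "norm (\<Sum>i\<in>I. v i) powr p \<le> (\<Sum>i\<in>I. norm (v i)) powr p"
    using p by (intro powr_mono2 norm_sum) auto
  also have "\<dots> \<le> real (card I) powr (p - 1) * (\<Sum>i\<in>I. norm (v i) powr p)"
    by (rule powr_sum_le[OF fin p]) auto
  finally show ?thesis .
qed

text \<open>The p-th power of an L^p norm for counting measure. Without root and normalisation the
  estimates stay additive, and the powers of the cardinality cancel at the end.\<close>

definition lp_sum :: "real \<Rightarrow> 'b set \<Rightarrow> ('b \<Rightarrow> 'a::real_normed_vector) \<Rightarrow> real" where
  "lp_sum p S h = (\<Sum>x\<in>S. norm (h x) powr p)"

lemma lp_sum_nonneg [simp]: "0 \<le> lp_sum p S h"
  by (simp add: lp_sum_def sum_nonneg)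

lemma lp_sum_scaleR: "lp_sum p S (\<lambda>x. c *\<^sub>R h x) = \<bar>c\<bar> powr p * lp_sum p S h"
  by (simp add: lp_sum_def powr_mult sum_distrib_left)

lemma lp_sum_uminus: "lp_sum p S (\<lambda>x. - h x) = lp_sum p S h"
  by (simp add: lp_sum_def)

lemma lp_sum_sum_le:
  assumes "finite I" "1 \<le> p"
  shows "lp_sum p S (\<lambda>x. \<Sum>i\<in>I. h i x) \<le> real (card I) powr (p - 1) * (\<Sum>i\<in>I. lp_sum p S (h i))"
proof -
  have "lp_sum p S (\<lambda>x. \<Sum>i\<in>I. h i x)
      \<le> (\<Sum>x\<in>S. real (card I) powr (p - 1) * (\<Sum>i\<in>I. norm (h i x) powr p))"
    unfolding lp_sum_def by (intro sum_mono norm_sum_powr_le assms)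
  also have "\<dots> = real (card I) powr (p - 1) * (\<Sum>i\<in>I. lp_sum p S (h i))"
    unfolding lp_sum_def sum_distrib_left[symmetric] by (subst sum.swap) simp
  finally show ?thesis .
qed

text \<open>For terms with a common bound, convexity loses nothing against Minkowski's inequality:
  \<open>card I\<close> functions of norm at most c add up to a function of norm at most c times
  \<open>card I\<close>.\<close>

lemma lp_sum_sum_le_const:
  assumes "finite I" "1 \<le> p" and "0 \<le> C" and le: "\<And>i. i \<in> I \<Longrightarrow> lp_sum p S (h i) \<le> C"
  shows "lp_sum p S (\<lambda>x. \<Sum>i\<in>I. h i x) \<le> real (card I) powr p * C"
proof -
  have "lp_sum p S (\<lambda>x. \<Sum>i\<in>I. h i x) \<le> real (card I) powr (p - 1) * (\<Sum>i\<in>I. lp_sum p S (h i))"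
    by (rule lp_sum_sum_le[OF assms(1,2)])
  also have "\<dots> \<le> real (card I) powr (p - 1) * (real (card I) * C)"
    using sum_bounded_above[of I "\<lambda>i. lp_sum p S (h i)" C] le by (intro mult_left_mono) auto
  also have "\<dots> = real (card I) powr p * C"
    by (cases "card I = 0") (auto simp: powr_diff)
  finally show ?thesis .
qed

lemma lp_sum_add_le:
  assumes "1 \<le> p"
  shows "lp_sum p S (\<lambda>x. u x + v x) \<le> 2 powr (p - 1) * (lp_sum p S u + lp_sum p S v)"
  using lp_sum_sum_le[of "UNIV :: bool set" p S "\<lambda>b. if b then u else v"] assms
  by (simp add: UNIV_bool add.commute)

lemma lp_sum_add3_le:
  assumes "1 \<le> p"
  shows "lp_sum p S (\<lambda>x. u x + v x + w x)
    \<le> 3 powr (p - 1) * (lp_sum p S u + lp_sum p S v + lp_sum p S w)"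
  using lp_sum_sum_le[of "{0, 1, 2 :: nat}" p S
      "\<lambda>i. if i = 0 then u else if i = 1 then v else w"] assms
  by (simp add: add.assoc)

lemma lp_sum_add_le_const:
  assumes "1 \<le> p" "lp_sum p S u \<le> C" "lp_sum p S v \<le> C"
  shows "lp_sum p S (\<lambda>x. u x + v x) \<le> 2 powr p * C"
proof -
  have "lp_sum p S (\<lambda>x. u x + v x) \<le> 2 powr (p - 1) * (lp_sum p S u + lp_sum p S v)"
    by (rule lp_sum_add_le[OF assms(1)])
  also have "\<dots> \<le> 2 powr (p - 1) * (2 * C)"
    using assms by (intro mult_left_mono) auto
  finally show ?thesis by (simp add: powr_diff)
qed

section \<open>Periodic functions on the integer lattice\<close>

definition wrap :: "nat \<Rightarrow> nat \<Rightarrow> (nat \<Rightarrow> int) \<Rightarrow> nat \<Rightarrow> int" where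
  "wrap m n z = (\<lambda>i\<in>{1..n}. z i mod int m)"

text \<open>As \<open>wrap\<close> forgets everything outside {1..n}, this also says that
  \<open>h\<close> ignores those coordinates. Functions on the torus become functions on all of
  \<open>nat \<Rightarrow> int\<close>, where a shift is plain addition.\<close>

definition periodic :: "nat \<Rightarrow> nat \<Rightarrow> ((nat \<Rightarrow> int) \<Rightarrow> 'b) \<Rightarrow> bool" where
  "periodic m n h \<longleftrightarrow> (\<forall>z. h (wrap m n z) = h z)"

lemma torus_add_eq_wrap: "torus_add m n x y = wrap m n (x + y)"
  by (simp add: torus_add_def wrap_def)

lemma wrap_in_torus: "0 < m \<Longrightarrow> wrap m n z \<in> torus m n"
  by (auto simp: wrap_def torus_def)

lemma wrap_id: "x \<in> torus m n \<Longrightarrow> wrap m n x = x"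
  by (auto simp: wrap_def torus_def PiE_def Pi_def extensional_def fun_eq_iff)

lemma wrap_add_left: "wrap m n (wrap m n x + y) = wrap m n (x + y)"
  by (auto simp: wrap_def fun_eq_iff mod_simps)

lemma periodic_compose_wrap: "periodic m n (\<lambda>z. f (wrap m n z))"
  using wrap_add_left[of m n _ 0] by (simp add: periodic_def)

lemma periodicD_cong:
  assumes "periodic m n h" "\<And>i. i \<in> {1..n} \<Longrightarrow> z i mod int m = z' i mod int m"
  shows "h z = h z'"
proof -
  have "wrap m n z = wrap m n z'" using assms(2) by (auto simp: wrap_def fun_eq_iff)
  then show ?thesis using assms(1) unfolding periodic_def by metis
qed

lemma periodic_shift: "periodic m n h \<Longrightarrow> periodic m n (\<lambda>x. h (x + y))"
  unfolding periodic_def by (metis wrap_add_left)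

lemma periodic_map: "periodic m n h \<Longrightarrow> periodic m n (\<lambda>x. g (h x))"
  by (simp add: periodic_def)

lemma periodic_map2: "periodic m n h \<Longrightarrow> periodic m n h' \<Longrightarrow> periodic m n (\<lambda>x. g (h x) (h' x))"
  by (simp add: periodic_def)

lemma finite_torus [simp]: "finite (torus m n)"
  by (simp add: torus_def finite_PiE)

lemma card_torus: "card (torus m n) = m ^ n"
  by (simp add: torus_def card_PiE)

lemma torus_nonempty: "0 < m \<Longrightarrow> torus m n \<noteq> {}"
  using wrap_in_torus[of m n 0] by blast

lemma finite_sign_cube [simp]: "finite (sign_cube n)"
  by (simp add: sign_cube_def finite_PiE)

lemma card_sign_cube: "card (sign_cube n) = 2 ^ n"
  by (simp add: sign_cube_def card_PiE numeral_2_eq_2)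

lemma sign_cube_nonempty: "sign_cube n \<noteq> {}"
  by (simp add: sign_cube_def PiE_eq_empty_iff)

text \<open>Translation by \<open>y\<close> permutes the torus, with translation by
  \<open>- y\<close> as inverse; periodicity then removes the reduction modulo
  \<open>m\<close>.\<close>

lemma sum_torus_shift:
  assumes m: "0 < m" and h: "periodic m n h"
  shows "(\<Sum>x\<in>torus m n. h (x + y)) = (\<Sum>x\<in>torus m n. h x)"
proof -
  have "(\<Sum>x\<in>torus m n. h (wrap m n (x + y))) = (\<Sum>x\<in>torus m n. h x)"
    by (rule sum.reindex_bij_witness[of _ "\<lambda>x. wrap m n (x + - y)" "\<lambda>x. wrap m n (x + y)"])
       (simp_all add: wrap_in_torus[OF m] wrap_add_left wrap_id add.assoc del: add_uminus_conv_diff)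
  then show ?thesis using h by (simp add: periodic_def)
qed

lemma lp_sum_shift:
  assumes "0 < m" "periodic m n h"
  shows "lp_sum p (torus m n) (\<lambda>x. h (x + y)) = lp_sum p (torus m n) h"
  unfolding lp_sum_def using sum_torus_shift[OF assms(1) periodic_map[OF assms(2)]] .

section \<open>Increments along lattice paths\<close>

definition smult_vec :: "int \<Rightarrow> (nat \<Rightarrow> int) \<Rightarrow> nat \<Rightarrow> int" where
  "smult_vec c y = (\<lambda>i. c * y i)"

text \<open>For growing \<open>j\<close> these are the corners of a lattice path that starts at 0
  and adjusts the coordinates to those of \<open>y\<close> one after the other.\<close>

definition truncate_vec :: "nat \<Rightarrow> (nat \<Rightarrow> int) \<Rightarrow> nat \<Rightarrow> int" where
  "truncate_vec j y = (\<lambda>i. if i \<in> {1..j} then y i else 0)"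

definition partial_diff :: "((nat \<Rightarrow> int) \<Rightarrow> 'a::real_normed_vector) \<Rightarrow> nat \<Rightarrow> (nat \<Rightarrow> int) \<Rightarrow> 'a" where
  "partial_diff F j = (\<lambda>x. F (x + std_basis j) - F x)"

lemma periodic_partial_diff: "periodic m n F \<Longrightarrow> periodic m n (partial_diff F j)"
  unfolding partial_diff_def by (intro periodic_map2[of _ _ _ _ minus] periodic_shift)

lemma periodic_increment: "periodic m n F \<Longrightarrow> periodic m n (\<lambda>x. F (x + y) - F x)"
  by (intro periodic_map2[of _ _ _ _ minus] periodic_shift)

lemma telescope_smult_vec:
  fixes F :: "(nat \<Rightarrow> int) \<Rightarrow> 'a::real_normed_vector"
  shows "F (x + smult_vec (int t) y) - F x
    = (\<Sum>s<t. F (x + smult_vec (int s) y + y) - F (x + smult_vec (int s) y))"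
proof -
  have "x + smult_vec (int s) y + y = x + smult_vec (int (Suc s)) y" for s
    by (simp add: smult_vec_def fun_eq_iff algebra_simps)
  moreover have "x + smult_vec (int 0) y = x" by (simp add: smult_vec_def fun_eq_iff)
  ultimately show ?thesis
    using sum_lessThan_telescope[of "\<lambda>s. F (x + smult_vec (int s) y)" t] by (simp only:)
qed

lemma telescope_truncate_vec:
  fixes F :: "(nat \<Rightarrow> int) \<Rightarrow> 'a::real_normed_vector"
  assumes "periodic m n F"
  shows "F (x + y) - F x
    = (\<Sum>j=1..n. F (x + truncate_vec j y) - F (x + truncate_vec (j - 1) y))"
proof -
  \<comment> \<open>The arguments can differ only outside {1..n}, where a periodic function is
    blind.\<close>
  have "F (x + y) = F (x + truncate_vec n y)"
    by (rule periodicD_cong[OF assms]) (simp add: truncate_vec_def)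
  moreover have "F x = F (x + truncate_vec 0 y)"
    by (simp add: truncate_vec_def plus_fun_def)
  ultimately show ?thesis
    using sum_telescope''[of 0 n "\<lambda>j. F (x + truncate_vec j y)"] by simp
qed

lemma truncate_vec_step:
  "1 \<le> j \<Longrightarrow> truncate_vec j y = truncate_vec (j - 1) y + smult_vec (y j) (std_basis j)"
  by (auto simp: truncate_vec_def smult_vec_def std_basis_def fun_eq_iff)

context
  fixes m n :: nat and p :: real
  assumes m: "0 < m" and p: "1 \<le> p"
begin

text \<open>The increment splits into \<open>t\<close> steps, each a translate of the first and
  hence of the same norm.\<close>

lemma lp_sum_multiple_increment_le:
  assumes F: "periodic m n F"
  shows "lp_sum p (torus m n) (\<lambda>x. F (x + smult_vec (int t) y) - F x)
    \<le> real t powr p * lp_sum p (torus m n) (\<lambda>x. F (x + y) - F x)"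
proof -
  have "lp_sum p (torus m n)
      (\<lambda>x. \<Sum>s<t. F (x + smult_vec (int s) y + y) - F (x + smult_vec (int s) y))
    \<le> real (card {..<t}) powr p * lp_sum p (torus m n) (\<lambda>x. F (x + y) - F x)"
  proof (rule lp_sum_sum_le_const)
    show "lp_sum p (torus m n) (\<lambda>x. F (x + smult_vec (int s) y + y) - F (x + smult_vec (int s) y))
      \<le> lp_sum p (torus m n) (\<lambda>x. F (x + y) - F x)" for s
      by (rule eq_refl, rule lp_sum_shift[OF m periodic_increment[OF F]])
  qed (use p in auto)
  then show ?thesis by (simp only: telescope_smult_vec card_lessThan)
qed

text \<open>Walk from \<open>x\<close> to \<open>x + y\<close> one coordinate at a time: there are
  \<open>n\<close> legs, the j-th consisting of fewer than \<open>k\<close> unit steps in direction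
  \<open>j\<close>, and convexity over the legs costs n^(p-1).\<close>

lemma lp_sum_box_increment_le:
  assumes F: "periodic m n F" and y: "\<And>i. i \<in> {1..n} \<Longrightarrow> y i \<in> {0..<int k}"
  shows "lp_sum p (torus m n) (\<lambda>x. F (x + y) - F x)
    \<le> (real n * real k) powr p * (\<Sum>j=1..n. lp_sum p (torus m n) (partial_diff F j))"
proof -
  let ?P = "lp_sum p (torus m n)"
  have step: "?P (\<lambda>x. F (x + truncate_vec j y) - F (x + truncate_vec (j - 1) y))
      \<le> real k powr p * ?P (partial_diff F j)" if j: "j \<in> {1..n}" for j
  proof -
    define t where "t = nat (y j)"
    have t: "y j = int t" "t \<le> k" using y[OF j] by (auto simp: t_def)
    have "?P (\<lambda>x. F (x + truncate_vec j y) - F (x + truncate_vec (j - 1) y))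
        = ?P (\<lambda>x. F (x + truncate_vec (j - 1) y + smult_vec (int t) (std_basis j))
               - F (x + truncate_vec (j - 1) y))"
      using j by (simp add: truncate_vec_step[of j] t add.assoc)
    also have "\<dots> = ?P (\<lambda>x. F (x + smult_vec (int t) (std_basis j)) - F x)"
      by (rule lp_sum_shift[OF m periodic_increment[OF F]])
    also have "\<dots> \<le> real t powr p * ?P (partial_diff F j)"
      unfolding partial_diff_def by (rule lp_sum_multiple_increment_le[OF F])
    also have "\<dots> \<le> real k powr p * ?P (partial_diff F j)"
      using t p by (intro mult_right_mono powr_mono2) auto
    finally show ?thesis .
  qed
  have "?P (\<lambda>x. F (x + y) - F x)
      = ?P (\<lambda>x. \<Sum>j=1..n. F (x + truncate_vec j y) - F (x + truncate_vec (j - 1) y))"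
    by (simp only: telescope_truncate_vec[OF F, of _ y])
  also have "\<dots> \<le> real n powr (p - 1) *
      (\<Sum>j=1..n. ?P (\<lambda>x. F (x + truncate_vec j y) - F (x + truncate_vec (j - 1) y)))"
    using lp_sum_sum_le[of "{1..n}" p] p by simp
  also have "\<dots> \<le> real n powr (p - 1) * (\<Sum>j=1..n. real k powr p * ?P (partial_diff F j))"
    by (intro mult_left_mono sum_mono step) auto
  \<comment> \<open>The exponent is relaxed so that the factor becomes a power of n * k, which will
    be half the period.\<close>
  also have "\<dots> \<le> real n powr p * (\<Sum>j=1..n. real k powr p * ?P (partial_diff F j))"
    by (cases "n = 0") (auto intro!: mult_right_mono powr_mono sum_nonneg)
  also have "\<dots> = (real n * real k) powr p * (\<Sum>j=1..n. ?P (partial_diff F j))"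
    by (simp add: powr_mult sum_distrib_left mult.assoc)
  finally show ?thesis .
qed

end

text \<open>The point at which the \<open>j\<close>-th step of a path from \<open>0\<close> to \<open>\<epsilon>\<close>, traversed in the positive
  direction, starts.\<close>

definition sign_path :: "nat \<Rightarrow> (nat \<Rightarrow> int) \<Rightarrow> nat \<Rightarrow> int" where
  "sign_path j \<epsilon> = truncate_vec (j - 1) \<epsilon> + (if \<epsilon> j = 1 then 0 else - std_basis j)"

lemma sign_cubeD: "\<epsilon> \<in> sign_cube n \<Longrightarrow> j \<in> {1..n} \<Longrightarrow> \<epsilon> j = 1 \<or> \<epsilon> j = -1"
  by (auto simp: sign_cube_def)

text \<open>At coordinate \<open>j\<close> the truncation to the first \<open>j - 1\<close>
  coordinates vanishes, so subtracting the basis vector leads no further than -1.\<close>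

lemma sign_path_bounds:
  assumes "\<epsilon> \<in> sign_cube n" "j \<in> {1..n}"
  shows "sign_path j \<epsilon> i \<in> {-1, 0, 1}" "i \<notin> {1..n} \<Longrightarrow> sign_path j \<epsilon> i = 0"
  using assms sign_cubeD[OF assms(1), of i]
  by (cases "i \<in> {1..n}"; auto simp: sign_path_def truncate_vec_def std_basis_def)+

text \<open>An edge traversed backwards contributes minus the forward difference at its other end.
  This pulls the sign \<epsilon> j out as a factor and produces a Rademacher sum, except that the
  base points still depend on \<epsilon>.\<close>

lemma sign_increment_eq:
  fixes F :: "(nat \<Rightarrow> int) \<Rightarrow> 'a::real_normed_vector"
  assumes F: "periodic m n F" and e: "\<epsilon> \<in> sign_cube n"
  shows "F (x + \<epsilon>) - F x
    = (\<Sum>j=1..n. real_of_int (\<epsilon> j) *\<^sub>R partial_diff F j (x + sign_path j \<epsilon>))"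
proof -
  have "F (x + truncate_vec j \<epsilon>) - F (x + truncate_vec (j - 1) \<epsilon>)
      = real_of_int (\<epsilon> j) *\<^sub>R partial_diff F j (x + sign_path j \<epsilon>)" if j: "j \<in> {1..n}" for j
  proof -
    have jt: "truncate_vec j \<epsilon> = truncate_vec (j - 1) \<epsilon> + smult_vec (\<epsilon> j) (std_basis j)"
      using j by (intro truncate_vec_step) auto
    have s: "smult_vec 1 (std_basis j) = std_basis j" "smult_vec (-1) (std_basis j) = - std_basis j"
      by (auto simp: smult_vec_def)
    from sign_cubeD[OF e j] show ?thesis
      by (auto simp: jt s sign_path_def partial_diff_def add.assoc)
  qed
  then show ?thesis unfolding telescope_truncate_vec[OF F, of x \<epsilon>] by (intro sum.cong) auto
qed

section \<open>Box averages\<close>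

text \<open>The default value is 0, not \<open>undefined\<close>, so that differences with vectors
  supported in {1..n} again vanish outside {1..n}.\<close>

definition lattice_box :: "nat \<Rightarrow> nat \<Rightarrow> (nat \<Rightarrow> int) set" where
  "lattice_box n k = PiE_dflt {1..n} 0 (\<lambda>_. {0..<int k})"

lemma finite_lattice_box [simp]: "finite (lattice_box n k)"
  by (auto simp: lattice_box_def)

lemma card_lattice_box: "card (lattice_box n k) = k ^ n"
  by (simp add: lattice_box_def card_PiE_dflt)

text \<open>The two boxes differ only near their boundary: both contain the box obtained by removing
  one layer from each face, which by Bernoulli's inequality misses at most a fraction
  \<open>2n/k\<close> of the points of either of them.\<close>

lemma lp_sum_box_shift_le:
  assumes m: "0 < m" and p: "1 \<le> p" and k: "2 \<le> k" and h: "periodic m n h"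
    and w: "\<And>i. w i \<in> {-1, 0, 1}" "\<And>i. i \<notin> {1..n} \<Longrightarrow> w i = 0"
  shows "lp_sum p (torus m n) (\<lambda>x. (\<Sum>y\<in>lattice_box n k. h (x + y + w)) - (\<Sum>y\<in>lattice_box n k. h (x + y)))
    \<le> (4 * real n / real k * real k ^ n) powr p * lp_sum p (torus m n) h"
proof -
  let ?P = "lp_sum p (torus m n)"
  let ?B = "lattice_box n k"
  let ?B' = "(\<lambda>y. y + w) ` ?B"
  \<comment> \<open>The core: \<open>k - 2\<close> values per coordinate, so that a shift by at most
    1 in each coordinate stays inside the box.\<close>
  define I where "I = PiE_dflt {1..n} 0 (\<lambda>_. {1..<int k - 1})"
  define N where "N = 2 * real n / real k * real k ^ n"
  have cardI: "card I = (k - 2) ^ n"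
  proof -
    have "nat (int k - 1 - 1) = k - 2" using k by simp
    then show ?thesis by (simp add: I_def card_PiE_dflt)
  qed
  have bern: "real k ^ n - real (k - 2) ^ n \<le> N"
  proof -
    \<comment> \<open>Bernoulli's inequality requires -2/k >= -1, which is the assumption 2 <=
      k.\<close>
    have "1 + real n * (- 2 / real k) \<le> (1 + - 2 / real k) ^ n"
      using k by (intro Bernoulli_inequality) (auto simp: field_simps)
    also have "1 + - 2 / real k = real (k - 2) / real k"
      using k by (simp add: field_simps of_nat_diff)
    finally have "(1 - 2 * real n / real k) * real k ^ n \<le> (real (k - 2) / real k) ^ n * real k ^ n"
      by (intro mult_right_mono) (auto simp: algebra_simps)
    also have "\<dots> = real (k - 2) ^ n" using k by (simp add: power_divide)
    finally show ?thesis by (simp add: N_def algebra_simps)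
  qed
  have IB: "I \<subseteq> ?B" by (force simp: I_def lattice_box_def PiE_dflt_def)
  have IB': "I \<subseteq> ?B'"
  proof
    fix y assume y: "y \<in> I"
    have "y i - w i \<in> {0..<int k}" if "i \<in> {1..n}" for i
      using y w(1)[of i] that by (auto simp: I_def PiE_dflt_def)
    then have "y - w \<in> ?B"
      using y w(2) by (auto simp: I_def lattice_box_def PiE_dflt_def)
    then show "y \<in> ?B'" by (intro image_eqI[of _ _ "y - w"]) auto
  qed
  have inj: "inj_on (\<lambda>y. y + w) ?B" by (auto simp: inj_on_def)
  have small: "?P (\<lambda>x. \<Sum>y\<in>S - I. h (x + y)) \<le> N powr p * ?P h"
    if S: "finite S" "I \<subseteq> S" "card S = k ^ n" for S
  proof -
    have "?P (\<lambda>x. \<Sum>y\<in>S - I. h (x + y)) \<le> real (card (S - I)) powr p * ?P h"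
      using S by (intro lp_sum_sum_le_const p) (auto simp: lp_sum_shift[OF m h])
    moreover have "real (card (S - I)) \<le> N"
    proof -
      have "(k - 2) ^ n \<le> k ^ n" by (intro power_mono) auto
      then show ?thesis
        using S bern by (simp add: card_Diff_subset finite_subset cardI of_nat_diff)
    qed
    ultimately show ?thesis
      using p by (meson order_trans mult_right_mono powr_mono2 of_nat_0_le_iff lp_sum_nonneg
          order_trans[OF zero_le_one])
  qed
  \<comment> \<open>The core cancels in the difference and leaves the two boundary layers, each
    estimated by \<open>small\<close>.\<close>
  have "?P (\<lambda>x. (\<Sum>y\<in>?B. h (x + y + w)) - (\<Sum>y\<in>?B. h (x + y)))
      = ?P (\<lambda>x. (\<Sum>y\<in>?B' - I. h (x + y)) + - (\<Sum>y\<in>?B - I. h (x + y)))"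
  proof -
    have "(\<Sum>y\<in>?B. h (x + y + w)) - (\<Sum>y\<in>?B. h (x + y))
        = (\<Sum>y\<in>?B' - I. h (x + y)) + - (\<Sum>y\<in>?B - I. h (x + y))" for x
      using sum.reindex[OF inj, of "\<lambda>y. h (x + y)"]
        sum.subset_diff[OF IB, of "\<lambda>y. h (x + y)"] sum.subset_diff[OF IB', of "\<lambda>y. h (x + y)"]
      by (simp add: algebra_simps)
    then show ?thesis by simp
  qed
  also have "\<dots> \<le> 2 powr p * (N powr p * ?P h)"
    using small[OF _ IB] small[OF _ IB'] inj
    by (intro lp_sum_add_le_const p) (auto simp: lp_sum_uminus card_lattice_box card_image)
  also have "\<dots> = (2 * N) powr p * ?P h"
    by (simp add: powr_mult mult.assoc)
  also have "2 * N = 4 * real n / real k * real k ^ n" by (simp add: N_def)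
  finally show ?thesis .
qed

section \<open>From Rademacher type to scaled Enflo type\<close>

lemma uniform_expectation_sign_cube:
  "uniform_expectation (sign_cube n) g = (\<Sum>\<epsilon>\<in>sign_cube n. g \<epsilon>) / 2 ^ n"
  by (simp add: integral_pmf_of_set sign_cube_nonempty card_sign_cube)

lemma uniform_expectation_torus:
  "0 < m \<Longrightarrow> uniform_expectation (torus m n) g = (\<Sum>x\<in>torus m n. g x) / real m ^ n"
  by (simp add: integral_pmf_of_set torus_nonempty card_torus)

lemma rademacher_type_withD:
  assumes "rademacher_type_with TYPE('a::banach) p T"
  shows "(\<Sum>\<epsilon>\<in>sign_cube n. norm (\<Sum>j=1..n. real_of_int (\<epsilon> j) *\<^sub>R (x j :: 'a)) powr p)
    \<le> 2 ^ n * (T powr p * (\<Sum>j=1..n. norm (x j) powr p))"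
  using assms unfolding rademacher_type_with_def uniform_expectation_sign_cube
  by (simp add: divide_le_eq mult.commute)

text \<open>For n = 1 the type inequality compares the norm of \<open>v\<close> with
  \<open>T\<close> times itself. The bound allows error terms to be absorbed into powers of
  \<open>T\<close>.\<close>

lemma rademacher_const_ge_1:
  assumes R: "rademacher_type_with TYPE('a::banach) p T" and p: "1 \<le> p" and v: "v \<noteq> (0 :: 'a)"
  shows "1 \<le> T"
proof (rule ccontr)
  assume "\<not> 1 \<le> T"
  then have T: "0 \<le> T" "T < 1" using R by (auto simp: rademacher_type_with_def)
  have "norm (real_of_int (\<epsilon> 1) *\<^sub>R v) powr p = norm v powr p" if "\<epsilon> \<in> sign_cube 1" for \<epsilon>
    using sign_cubeD[OF that, of 1] by auto
  then have "2 * norm v powr p \<le> 2 * (T powr p * norm v powr p)"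
    using rademacher_type_withD[OF R, where n = 1 and x = "\<lambda>_. v"] card_sign_cube[of 1] by simp
  then have "1 \<le> T powr p" using v by simp
  moreover have "T powr p < 1 powr p" using T p by (intro powr_less_mono2) auto
  ultimately show False by simp
qed

text \<open>Along a path from \<open>x\<close> to \<open>x + \<epsilon>\<close> the increment of the average \<open>g\<close> is
  \<open>\<Sum>j. \<epsilon> j * (c j + r \<epsilon> j)\<close>, where \<open>c j\<close> does not depend on \<open>\<epsilon>\<close>, so that the type inequality
  applies to it, and \<open>r \<epsilon> j\<close> is the effect of shifting the box. The side \<open>4n\<^sup>2\<close> makes the
  latter contribution at most the former.\<close>

lemma lp_sum_smoothed_increment_le:
  fixes F :: "(nat \<Rightarrow> int) \<Rightarrow> 'a::banach" and n :: nat
  defines "k \<equiv> 4 * n ^ 2"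
  defines "g \<equiv> \<lambda>x. (1 / real k ^ n) *\<^sub>R (\<Sum>y\<in>lattice_box n k. F (x + y))"
  assumes R: "rademacher_type_with TYPE('a) p T" and T: "1 \<le> T" and p: "1 \<le> p"
    and m: "0 < m" and n: "0 < n" and F: "periodic m n F"
  shows "(\<Sum>\<epsilon>\<in>sign_cube n. lp_sum p (torus m n) (\<lambda>x. g (x + \<epsilon>) - g x))
    \<le> 2 ^ n * ((2 * T) powr p * (\<Sum>j=1..n. lp_sum p (torus m n) (partial_diff F j)))"
proof -
  let ?P = "lp_sum p (torus m n)"
  let ?B = "lattice_box n k"
  let ?d = "partial_diff F"
  define D where "D = (\<Sum>j=1..n. ?P (?d j))"
  define N where "N = real k ^ n"
  define c where "c = (\<lambda>j x. (1 / N) *\<^sub>R (\<Sum>y\<in>?B. ?d j (x + y)))"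
  define r where "r = (\<lambda>\<epsilon> j x. (1 / N) *\<^sub>R
    ((\<Sum>y\<in>?B. ?d j (x + y + sign_path j \<epsilon>)) - (\<Sum>y\<in>?B. ?d j (x + y))))"
  have k: "2 \<le> k" using n by (cases n) (auto simp: k_def power2_eq_square)
  have N: "0 < N" using k by (simp add: N_def)
  have D: "0 \<le> D" by (simp add: D_def sum_nonneg)
  have Pc: "?P (c j) \<le> ?P (?d j)" for j
  proof -
    have "?P (\<lambda>x. \<Sum>y\<in>?B. ?d j (x + y)) \<le> real (card ?B) powr p * ?P (?d j)"
      using lp_sum_shift[OF m periodic_partial_diff[OF F]]
      by (intro lp_sum_sum_le_const p) auto
    then have "(1 / N) powr p * ?P (\<lambda>x. \<Sum>y\<in>?B. ?d j (x + y))
        \<le> (1 / N) powr p * (N powr p * ?P (?d j))"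
      by (intro mult_left_mono) (auto simp: card_lattice_box N_def)
    also have "\<dots> = ?P (?d j)" using N by (simp flip: mult.assoc powr_mult)
    finally show ?thesis using N by (simp add: c_def lp_sum_scaleR)
  qed
  have Pr: "?P (r \<epsilon> j) \<le> (1 / real n) powr p * ?P (?d j)"
    if e: "\<epsilon> \<in> sign_cube n" and j: "j \<in> {1..n}" for \<epsilon> j
  proof -
    have "?P (\<lambda>x. (\<Sum>y\<in>?B. ?d j (x + y + sign_path j \<epsilon>)) - (\<Sum>y\<in>?B. ?d j (x + y)))
        \<le> (4 * real n / real k * real k ^ n) powr p * ?P (?d j)"
      by (rule lp_sum_box_shift_le[OF m p k periodic_partial_diff[OF F]])
         (use sign_path_bounds[OF e j] in auto)
    then have "?P (r \<epsilon> j) \<le> (1 / N) powr p * ((4 * real n / real k * N) powr p * ?P (?d j))"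
      using N by (simp add: r_def lp_sum_scaleR N_def mult_left_mono)
    also have "\<dots> = (1 / N * (4 * real n / real k * N)) powr p * ?P (?d j)"
      using N k by (subst (2) powr_mult) (auto simp: mult.assoc)
    \<comment> \<open>The side k = 4n^2 is chosen for this identity.\<close>
    also have "1 / N * (4 * real n / real k * N) = 1 / real n"
      using N n by (simp add: k_def power2_eq_square)
    finally show ?thesis .
  qed
  have decomp: "g (x + \<epsilon>) - g x
      = (\<Sum>j=1..n. real_of_int (\<epsilon> j) *\<^sub>R c j x) + (\<Sum>j=1..n. real_of_int (\<epsilon> j) *\<^sub>R r \<epsilon> j x)"
    if e: "\<epsilon> \<in> sign_cube n" for \<epsilon> x
  proof -
    have "g (x + \<epsilon>) - g x = (1 / N) *\<^sub>R (\<Sum>y\<in>?B. F (x + y + \<epsilon>) - F (x + y))"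
      by (simp add: g_def N_def sum_subtractf scaleR_diff_right ac_simps)
    also have "\<dots> = (1 / N) *\<^sub>R
        (\<Sum>y\<in>?B. \<Sum>j=1..n. real_of_int (\<epsilon> j) *\<^sub>R ?d j (x + y + sign_path j \<epsilon>))"
      by (simp only: sign_increment_eq[OF F e])
    also have "\<dots> = (\<Sum>j=1..n. real_of_int (\<epsilon> j) *\<^sub>R
        ((1 / N) *\<^sub>R (\<Sum>y\<in>?B. ?d j (x + y + sign_path j \<epsilon>))))"
      by (subst sum.swap) (simp add: scaleR_sum_right mult.commute)
    also have "\<dots> = (\<Sum>j=1..n. real_of_int (\<epsilon> j) *\<^sub>R (c j x + r \<epsilon> j x))"
      by (simp add: c_def r_def scaleR_diff_right)
    finally show ?thesis by (simp add: scaleR_add_right sum.distrib)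
  qed
  have error: "?P (\<lambda>x. \<Sum>j=1..n. real_of_int (\<epsilon> j) *\<^sub>R r \<epsilon> j x) \<le> D"
    if e: "\<epsilon> \<in> sign_cube n" for \<epsilon>
  proof -
    have "?P (\<lambda>x. real_of_int (\<epsilon> j) *\<^sub>R r \<epsilon> j x) \<le> (1 / real n) powr p * ?P (?d j)"
      if j: "j \<in> {1..n}" for j
      using Pr[OF e j] sign_cubeD[OF e j] by (auto simp: lp_sum_scaleR)
    then have "?P (\<lambda>x. \<Sum>j=1..n. real_of_int (\<epsilon> j) *\<^sub>R r \<epsilon> j x)
        \<le> real n powr (p - 1) * (\<Sum>j=1..n. (1 / real n) powr p * ?P (?d j))"
      using p by (intro order_trans[OF lp_sum_sum_le]) (auto intro!: mult_left_mono sum_mono)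
    also have "\<dots> = (real n powr (p - 1) * (1 / real n) powr p) * D"
      by (simp add: D_def sum_distrib_left mult.assoc)
    \<comment> \<open>The factor on the left equals n^(p-1) * n^(-p) = 1/n.\<close>
    also have "\<dots> \<le> 1 * D"
      using n D by (intro mult_right_mono) (auto simp: powr_diff powr_divide)
    finally show ?thesis by simp
  qed
  have main: "(\<Sum>\<epsilon>\<in>sign_cube n. ?P (\<lambda>x. \<Sum>j=1..n. real_of_int (\<epsilon> j) *\<^sub>R c j x))
      \<le> 2 ^ n * (T powr p * D)"
  proof -
    have "(\<Sum>\<epsilon>\<in>sign_cube n. ?P (\<lambda>x. \<Sum>j=1..n. real_of_int (\<epsilon> j) *\<^sub>R c j x))
        = (\<Sum>x\<in>torus m n. \<Sum>\<epsilon>\<in>sign_cube n. norm (\<Sum>j=1..n. real_of_int (\<epsilon> j) *\<^sub>R c j x) powr p)"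
      unfolding lp_sum_def by (rule sum.swap)
    also have "\<dots> \<le> (\<Sum>x\<in>torus m n. 2 ^ n * (T powr p * (\<Sum>j=1..n. norm (c j x) powr p)))"
      by (intro sum_mono rademacher_type_withD[OF R])
    also have "\<dots> = 2 ^ n * (T powr p * (\<Sum>j=1..n. ?P (c j)))"
      unfolding sum_distrib_left[symmetric] lp_sum_def by (subst sum.swap) simp
    also have "\<dots> \<le> 2 ^ n * (T powr p * D)"
      unfolding D_def by (intro mult_left_mono sum_mono Pc) auto
    finally show ?thesis .
  qed
  have "(\<Sum>\<epsilon>\<in>sign_cube n. ?P (\<lambda>x. g (x + \<epsilon>) - g x))
      \<le> (\<Sum>\<epsilon>\<in>sign_cube n. 2 powr (p - 1) * (?P (\<lambda>x. \<Sum>j=1..n. real_of_int (\<epsilon> j) *\<^sub>R c j x) + D))"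
  proof (rule sum_mono)
    fix \<epsilon> assume e: "\<epsilon> \<in> sign_cube n"
    show "?P (\<lambda>x. g (x + \<epsilon>) - g x)
      \<le> 2 powr (p - 1) * (?P (\<lambda>x. \<Sum>j=1..n. real_of_int (\<epsilon> j) *\<^sub>R c j x) + D)"
      unfolding decomp[OF e] using error[OF e]
      by (intro order_trans[OF lp_sum_add_le[OF p]] mult_left_mono add_left_mono) auto
  qed
  also have "\<dots> = 2 powr (p - 1) *
      ((\<Sum>\<epsilon>\<in>sign_cube n. ?P (\<lambda>x. \<Sum>j=1..n. real_of_int (\<epsilon> j) *\<^sub>R c j x)) + 2 ^ n * D)"
    by (simp add: sum.distrib card_sign_cube flip: sum_distrib_left)
  \<comment> \<open>Since T^p >= 1, the error is at most the bound for the main term; the two equal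
    terms turn 2^(p-1) into 2^p.\<close>
  also have "\<dots> \<le> 2 powr (p - 1) * (2 ^ n * (T powr p * D) + 2 ^ n * (T powr p * D))"
    using main D T p by (intro mult_left_mono add_mono) (auto simp: mult_le_cancel_right1 ge_one_powr_ge_zero)
  also have "\<dots> = 2 ^ n * ((2 * T) powr p * D)"
    using T by (simp add: powr_mult powr_diff)
  finally show ?thesis by (simp add: D_def)
qed

text \<open>With h = n * k = m/2, the increment of \<open>F\<close> is split into F - g at the far
  end, g - F at the near end, and the increment of \<open>g\<close> over \<open>h\<close> steps. All
  three carry the factor h^p, and the constant arises as 3 * (2 * T) * h = 3 * T * m.\<close>

lemma scaled_enflo_inequality:
  fixes F :: "(nat \<Rightarrow> int) \<Rightarrow> 'a::banach" and n :: nat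
  defines "k \<equiv> 4 * n ^ 2"
  defines "m \<equiv> 2 * (n * k)"
  assumes R: "rademacher_type_with TYPE('a) p T" and T: "1 \<le> T" and p: "1 \<le> p"
    and n: "0 < n" and F: "periodic m n F"
  shows "(\<Sum>\<epsilon>\<in>sign_cube n. lp_sum p (torus m n) (\<lambda>x. F (x + smult_vec (int (n * k)) \<epsilon>) - F x))
    \<le> 2 ^ n * ((3 * T * real m) powr p * (\<Sum>j=1..n. lp_sum p (torus m n) (partial_diff F j)))"
proof -
  let ?P = "lp_sum p (torus m n)"
  let ?B = "lattice_box n k"
  define D where "D = (\<Sum>j=1..n. ?P (partial_diff F j))"
  define N where "N = real k ^ n"
  define h where "h = n * k"
  define g where "g = (\<lambda>x. (1 / N) *\<^sub>R (\<Sum>y\<in>?B. F (x + y)))"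
  have k: "0 < k" and m: "0 < m" using n by (auto simp: k_def m_def)
  have N: "0 < N" using k by (simp add: N_def)
  have D: "0 \<le> D" by (simp add: D_def sum_nonneg)
  have per_g: "periodic m n g"
    using F[THEN periodic_shift] by (simp add: periodic_def g_def)
  have Pg: "?P (\<lambda>x. g x - F x) \<le> real h powr p * D"
  proof -
    have "?P (\<lambda>x. \<Sum>y\<in>?B. F (x + y) - F x) \<le> real (card ?B) powr p * (real h powr p * D)"
    proof (intro lp_sum_sum_le_const p)
      fix y assume "y \<in> ?B"
      then show "?P (\<lambda>x. F (x + y) - F x) \<le> real h powr p * D"
        using lp_sum_box_increment_le[OF m p F, of y k]
        by (auto simp: h_def D_def lattice_box_def PiE_dflt_def)
    qed (use D in auto)
    then have "(1 / N) powr p * ?P (\<lambda>x. \<Sum>y\<in>?B. F (x + y) - F x)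
        \<le> (1 / N) powr p * (N powr p * (real h powr p * D))"
      by (intro mult_left_mono) (auto simp: card_lattice_box N_def)
    also have "\<dots> = real h powr p * D" using N by (simp flip: mult.assoc powr_mult)
    finally have "?P (\<lambda>x. (1 / N) *\<^sub>R (\<Sum>y\<in>?B. F (x + y) - F x)) \<le> real h powr p * D"
      using N by (simp add: lp_sum_scaleR)
    moreover have "(1 / N) *\<^sub>R (\<Sum>y\<in>?B. F (x + y) - F x) = g x - F x" for x
    proof -
      have "(1 / N) *\<^sub>R (\<Sum>y\<in>?B. F x) = F x"
        using k by (simp add: card_lattice_box N_def sum_constant_scaleR)
      then show ?thesis by (simp add: g_def sum_subtractf scaleR_diff_right)
    qed
    ultimately show ?thesis by simp
  qed
  have Pg': "?P (\<lambda>x. F (x + y) - g (x + y)) \<le> real h powr p * D" for y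
    using lp_sum_shift[OF m periodic_map2[OF F per_g, of minus], of p y] Pg
      lp_sum_uminus[of p "torus m n" "\<lambda>x. g x - F x"] by simp
  have each: "?P (\<lambda>x. F (x + smult_vec (int h) \<epsilon>) - F x)
      \<le> 3 powr (p - 1) * (2 * (real h powr p * D) + real h powr p * ?P (\<lambda>x. g (x + \<epsilon>) - g x))" for \<epsilon>
  proof -
    let ?y = "smult_vec (int h) \<epsilon>"
    have "?P (\<lambda>x. F (x + ?y) - F x)
        = ?P (\<lambda>x. (F (x + ?y) - g (x + ?y)) + (g x - F x) + (g (x + ?y) - g x))"
      by simp
    also have "\<dots> \<le> 3 powr (p - 1) * (?P (\<lambda>x. F (x + ?y) - g (x + ?y)) + ?P (\<lambda>x. g x - F x)
        + ?P (\<lambda>x. g (x + ?y) - g x))"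
      by (rule lp_sum_add3_le[OF p])
    also have "\<dots> \<le> 3 powr (p - 1) *
        (real h powr p * D + real h powr p * D + real h powr p * ?P (\<lambda>x. g (x + \<epsilon>) - g x))"
      by (intro mult_left_mono add_mono Pg Pg' lp_sum_multiple_increment_le[OF m p per_g]) auto
    finally show ?thesis by (simp only: mult_2)
  qed
  have "(\<Sum>\<epsilon>\<in>sign_cube n. ?P (\<lambda>x. F (x + smult_vec (int h) \<epsilon>) - F x))
      \<le> (\<Sum>\<epsilon>\<in>sign_cube n. 3 powr (p - 1) *
          (2 * (real h powr p * D) + real h powr p * ?P (\<lambda>x. g (x + \<epsilon>) - g x)))"
    by (intro sum_mono each)
  also have "\<dots> = 3 powr (p - 1) * (2 ^ n * (2 * (real h powr p * D))
      + real h powr p * (\<Sum>\<epsilon>\<in>sign_cube n. ?P (\<lambda>x. g (x + \<epsilon>) - g x)))"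
    by (simp add: sum.distrib card_sign_cube flip: sum_distrib_left)
  also have "\<dots> \<le> 3 powr (p - 1) * (2 ^ n * (2 * (real h powr p * D))
      + real h powr p * (2 ^ n * ((2 * T) powr p * D)))"
    using lp_sum_smoothed_increment_le[OF R T p m n F]
    by (intro mult_left_mono add_left_mono) (auto simp: g_def N_def D_def k_def)
  also have "\<dots> = 3 powr (p - 1) * real h powr p * (2 ^ n * D) * (2 + (2 * T) powr p)"
    by (simp add: algebra_simps)
  \<comment> \<open>From T >= 1 and p >= 1 follows 2 <= (2T)^p; the factor 3 completes 3^(p-1) to
    3^p.\<close>
  also have "\<dots> \<le> 3 powr (p - 1) * real h powr p * (2 ^ n * D) * (3 * (2 * T) powr p)"
  proof (intro mult_left_mono)
    have "1 \<le> T powr p" "2 \<le> (2::real) powr p"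
      using T p powr_mono[of 1 p 2] by (simp_all add: ge_one_powr_ge_zero)
    then have "2 * 1 \<le> 2 powr p * T powr p" by (intro mult_mono) auto
    also have "\<dots> = (2 * T) powr p" using T by (simp add: powr_mult)
    finally show "2 + (2 * T) powr p \<le> 3 * (2 * T) powr p" by linarith
  qed (use D in auto)
  also have "\<dots> = 2 ^ n * ((3 * T * real m) powr p * D)"
  proof -
    have "(3::real) powr p * 2 powr p = 6 powr p" by (simp flip: powr_mult)
    then show ?thesis using T by (simp add: m_def h_def powr_mult powr_diff)
  qed
  finally show ?thesis by (simp add: D_def h_def)
qed

lemma uniform_expectation_increment:
  fixes f :: "(nat \<Rightarrow> int) \<Rightarrow> 'a::real_normed_vector"
  assumes "0 < m"
  shows "uniform_expectation (torus m n) (\<lambda>x. dist (f (torus_add m n x y)) (f x) powr p)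
    = lp_sum p (torus m n) (\<lambda>x. f (wrap m n (x + y)) - f (wrap m n x)) / real m ^ n"
  unfolding uniform_expectation_torus[OF assms] lp_sum_def
  by (simp add: torus_add_eq_wrap wrap_id dist_norm)

lemma rademacher_imp_scaled_enflo:
  assumes R: "rademacher_type_with TYPE('a::banach) p T" and p: "1 \<le> p"
  shows "scaled_enflo_type_with TYPE('a) p (5 * T)"
proof (cases "\<exists>v::'a. v \<noteq> 0")
  \<comment> \<open>In the zero space \<open>T\<close> may be smaller than 1, but all distances
    vanish and m = 2 serves.\<close>
  case False
  then have zero: "dist u v = 0" for u v :: 'a by (metis dist_self)
  show ?thesis
    using R by (auto simp: zero scaled_enflo_type_with_def rademacher_type_with_def simp del: dist_eq_0_iff
        intro!: exI[of _ 2])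
next
  case True
  then have T: "1 \<le> T" using rademacher_const_ge_1[OF R p] by blast
  show ?thesis
    unfolding scaled_enflo_type_with_def
  proof (intro conjI allI impI)
    fix n :: nat assume n: "0 < n"
    define k where "k = 4 * n ^ 2"
    define m where "m = 2 * (n * k)"
    have m: "0 < m" "even m" "m div 2 = n * k" using n by (auto simp: m_def k_def)
    have "uniform_expectation (sign_cube n) (\<lambda>\<epsilon>. uniform_expectation (torus m n) (\<lambda>x.
        dist (f (torus_add m n x (\<lambda>i. int (m div 2) * \<epsilon> i))) (f x) powr p))
      \<le> (5 * T) powr p * real m powr p * (\<Sum>j=1..n. uniform_expectation (torus m n) (\<lambda>x.
          dist (f (torus_add m n x (std_basis j))) (f x) powr p))" (is "?L \<le> ?R")
      for f :: "(nat \<Rightarrow> int) \<Rightarrow> 'a"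
    proof -
      define F where "F = (\<lambda>z. f (wrap m n z))"
      have F: "periodic m n F" unfolding F_def by (rule periodic_compose_wrap)
      have exp_eq: "uniform_expectation (torus m n) (\<lambda>x. dist (f (torus_add m n x y)) (f x) powr p)
          = lp_sum p (torus m n) (\<lambda>x. F (x + y) - F x) / real m ^ n" for y
        unfolding F_def by (rule uniform_expectation_increment[OF m(1)])
      let ?D = "\<Sum>j=1..n. lp_sum p (torus m n) (partial_diff F j)"
      have "?L = (\<Sum>\<epsilon>\<in>sign_cube n.
          lp_sum p (torus m n) (\<lambda>x. F (x + smult_vec (int (n * k)) \<epsilon>) - F x)) / real m ^ n / 2 ^ n"
        unfolding exp_eq uniform_expectation_sign_cube
        by (simp add: m(3) smult_vec_def flip: sum_divide_distrib)
      also have "\<dots> \<le> 2 ^ n * ((3 * T * real m) powr p * ?D) / real m ^ n / 2 ^ n"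
        using scaled_enflo_inequality[OF R T p n, of F] F
        by (intro divide_right_mono) (auto simp: m_def k_def)
      also have "\<dots> = (3 * T * real m) powr p * (?D / real m ^ n)"
        by simp
      \<comment> \<open>Here the factor 3 is relaxed to the 5 of the theorem.\<close>
      also have "\<dots> \<le> (5 * T * real m) powr p * (?D / real m ^ n)"
        using T p by (intro mult_right_mono powr_mono2) (auto intro!: sum_nonneg divide_nonneg_nonneg)
      also have "\<dots> = ?R"
        using T unfolding exp_eq by (simp add: powr_mult partial_diff_def sum_divide_distrib)
      finally show ?thesis .
    qed
    then show "\<exists>m>0. even m \<and> (\<forall>f :: (nat \<Rightarrow> int) \<Rightarrow> 'a.
        uniform_expectation (sign_cube n) (\<lambda>\<epsilon>. uniform_expectation (torus m n) (\<lambda>x.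
          dist (f (torus_add m n x (\<lambda>i. int (m div 2) * \<epsilon> i))) (f x) powr p))
        \<le> (5 * T) powr p * real m powr p * (\<Sum>j=1..n. uniform_expectation (torus m n) (\<lambda>x.
            dist (f (torus_add m n x (std_basis j))) (f x) powr p)))"
      using m by (intro exI[of _ m]) blast
  qed (use T in auto)
qed

section \<open>From scaled Enflo type to Rademacher type\<close>

text \<open>The wave has period 2h, falls from h/2 at 0 to -h/2 at \<open>h\<close> and rises back.
  It is centred so that a shift by half a period changes its sign.\<close>

definition triangle_wave :: "nat \<Rightarrow> int \<Rightarrow> real" where
  "triangle_wave h z = \<bar>real_of_int (z mod int (2 * h)) - real h\<bar> - real h / 2"

lemma triangle_wave_mod [simp]: "triangle_wave h (z mod (2 * int h)) = triangle_wave h z"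
  by (simp add: triangle_wave_def)

lemma triangle_wave_cong: "z mod int (2 * h) = z' mod int (2 * h) \<Longrightarrow> triangle_wave h z = triangle_wave h z'"
  by (simp add: triangle_wave_def)

lemma triangle_wave_antiperiodic:
  assumes h: "0 < h"
  shows "triangle_wave h (z + int h) = - triangle_wave h z"
proof -
  define r where "r = z mod int (2 * h)"
  have r: "0 \<le> r" "r < 2 * int h" using h by (auto simp: r_def)
  have "(z + int h) mod int (2 * h) = (r + int h) mod int (2 * h)"
    by (simp add: r_def mod_simps)
  also have "\<dots> = (if r < int h then r + int h else r - int h)"
  proof (cases "r < int h")
    case False
    have "(r + int h) mod int (2 * h) = (r - int h + int (2 * h)) mod int (2 * h)"
      by (rule arg_cong[of _ _ "\<lambda>u. u mod int (2 * h)"]) simp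
    also have "\<dots> = r - int h" unfolding mod_add_self2 using r False by (intro mod_pos_pos_trivial) auto
    finally show ?thesis using False by simp
  qed (use r in auto)
  finally have "real_of_int ((z + int h) mod int (2 * h))
      = (if r < int h then real_of_int r + real h else real_of_int r - real h)" by simp
  moreover have "0 \<le> real_of_int r" "r < int h \<longleftrightarrow> real_of_int r < real h"
    "real_of_int r < 2 * real h" using r by linarith+
  ultimately show ?thesis
    unfolding triangle_wave_def r_def[symmetric] by (auto simp: abs_if field_simps)
qed

text \<open>Shifts by \<open>h\<close> and by \<open>- h\<close> agree modulo 2h, so the sign
  \<open>s\<close> does not affect the shifted value.\<close>

lemma triangle_wave_sign_shift:
  assumes "0 < h" "s = 1 \<or> s = -1"
  shows "triangle_wave h (z + int h * s) = - triangle_wave h z"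
proof -
  have "(z + - int h) mod int (2 * h) = (z + - int h + int (2 * h)) mod int (2 * h)"
    by (rule mod_add_self2[symmetric])
  also have "z + - int h + int (2 * h) = z + int h" by simp
  finally have "triangle_wave h (z + - int h) = triangle_wave h (z + int h)"
    by (rule triangle_wave_cong)
  then show ?thesis using assms triangle_wave_antiperiodic[OF assms(1), of z] by auto
qed

lemma triangle_wave_lipschitz:
  assumes h: "0 < h"
  shows "\<bar>triangle_wave h (z + 1) - triangle_wave h z\<bar> \<le> 1"
proof -
  define r where "r = z mod int (2 * h)"
  have r: "0 \<le> r" "r < 2 * int h" using h by (auto simp: r_def)
  have "(z + 1) mod int (2 * h) = (r + 1) mod int (2 * h)"
    by (simp add: r_def mod_simps)
  \<comment> \<open>At the end of the period the representative jumps, but the wave only moves from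
    h/2 - 1 to h/2.\<close>
  also have "\<dots> = (if r + 1 = 2 * int h then 0 else r + 1)"
    using r by auto
  finally have "real_of_int ((z + 1) mod int (2 * h))
      = (if real_of_int r + 1 = 2 * real h then 0 else real_of_int r + 1)" by (auto split: if_splits)
  then show ?thesis
    unfolding triangle_wave_def r_def[symmetric] by (auto split: if_splits)
qed

lemma sum_squares_centered:
  "(\<Sum>t<h. (real t - a) ^ 2) = real h * (real h - 1) * (2 * real h - 1) / 6 - a * real h * (real h - 1) + real h * a ^ 2"
  by (induction h) (auto simp: field_simps power2_eq_square)

text \<open>As the wave \<open>w\<close> is bounded by h/2, (h/2) * |w| >= w^2. The squares over
  half a period add up to h^3/12 + h/6 whatever the parity of \<open>h\<close>, and by
  antiperiodicity the other half contributes equally.\<close>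

lemma sum_abs_triangle_wave_ge:
  assumes h: "0 < h"
  shows "real h ^ 2 / 3 \<le> (\<Sum>t\<in>{0..<int (2 * h)}. \<bar>triangle_wave h t\<bar>)"
proof -
  have low: "(\<Sum>t<h. \<bar>triangle_wave h (int t)\<bar>) \<ge> real h ^ 2 / 6"
  proof -
    have tw: "triangle_wave h (int t) = - (real t - real h / 2)" if "t < h" for t
      using that by (simp add: triangle_wave_def)
    have "real h / 2 * \<bar>triangle_wave h (int t)\<bar> \<ge> (real t - real h / 2) ^ 2" if "t < h" for t
    proof -
      have "(real t - real h / 2) ^ 2 = \<bar>real t - real h / 2\<bar> * \<bar>real t - real h / 2\<bar>"
        by (simp add: power2_eq_square)
      also have "\<dots> \<le> real h / 2 * \<bar>real t - real h / 2\<bar>"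
      proof (intro mult_right_mono)
        have "real t < real h" using that by simp
        then show "\<bar>real t - real h / 2\<bar> \<le> real h / 2" by linarith
      qed auto
      finally show ?thesis using that by (simp add: tw abs_minus_commute)
    qed
    then have "(\<Sum>t<h. (real t - real h / 2) ^ 2) \<le> (\<Sum>t<h. real h / 2 * \<bar>triangle_wave h (int t)\<bar>)"
      by (intro sum_mono) auto
    also have "\<dots> = real h / 2 * (\<Sum>t<h. \<bar>triangle_wave h (int t)\<bar>)"
      by (simp add: sum_distrib_left)
    finally have "real h / 2 * (\<Sum>t<h. \<bar>triangle_wave h (int t)\<bar>) \<ge> real h ^ 3 / 12 + real h / 6"
      unfolding sum_squares_centered by (simp add: field_simps power2_eq_square power3_eq_cube)
    then have "real h / 2 * (\<Sum>t<h. \<bar>triangle_wave h (int t)\<bar>) \<ge> real h / 2 * (real h ^ 2 / 6)"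
      by (simp add: power2_eq_square power3_eq_cube)
    then show ?thesis using h by simp
  qed
  have "(\<Sum>t\<in>{0..<int (2 * h)}. \<bar>triangle_wave h t\<bar>) = (\<Sum>t<2 * h. \<bar>triangle_wave h (int t)\<bar>)"
    by (rule sum.reindex_bij_witness[of _ int nat]) auto
  also have "\<dots> = (\<Sum>t<h. \<bar>triangle_wave h (int t)\<bar>) + (\<Sum>t<h. \<bar>triangle_wave h (int t + int h)\<bar>)"
    by (simp add: mult_2 lessThan_atLeast0 sum.atLeastLessThan_concat[of 0 h "h + h", symmetric]
        sum.shift_bounds_nat_ivl[of _ 0 h h, simplified])
  finally show ?thesis using low by (simp add: triangle_wave_antiperiodic[OF h])
qed

text \<open>Written as a product over all coordinates with factor 1 away from \<open>j\<close>, the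
  summand lets the sum over the product set factor.\<close>

lemma sum_PiE_coordinate:
  fixes \<phi> :: "'c \<Rightarrow> real"
  assumes "finite I" "j \<in> I" "finite S"
  shows "(\<Sum>x\<in>I \<rightarrow>\<^sub>E S. \<phi> (x j)) = real (card S) ^ (card I - 1) * (\<Sum>s\<in>S. \<phi> s)"
proof -
  have "(\<Sum>x\<in>I \<rightarrow>\<^sub>E S. \<phi> (x j)) = (\<Sum>x\<in>I \<rightarrow>\<^sub>E S. \<Prod>i\<in>I. if i = j then \<phi> (x i) else 1)"
    using assms by (simp add: prod.delta')
  also have "\<dots> = (\<Prod>i\<in>I. \<Sum>s\<in>S. if i = j then \<phi> s else 1)"
    using assms by (subst prod_sum_PiE) auto
  also have "\<dots> = (\<Sum>s\<in>S. \<phi> s) * (\<Prod>i\<in>I - {j}. \<Sum>s\<in>S. if i = j then \<phi> s else 1)"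
    using assms by (subst prod.remove[of I j]) auto
  also have "(\<Prod>i\<in>I - {j}. \<Sum>s\<in>S. if i = j then \<phi> s else 1) = real (card S) ^ (card I - 1)"
    using assms by simp
  finally show ?thesis by simp
qed

text \<open>Flipping \<epsilon> j wherever \<open>a j\<close> is negative is an involution of the
  sign cube.\<close>

lemma sum_sign_cube_twist:
  fixes v :: "nat \<Rightarrow> 'a::real_normed_vector"
  shows "(\<Sum>\<epsilon>\<in>sign_cube n. norm (\<Sum>j=1..n. (real_of_int (\<epsilon> j) * a j) *\<^sub>R v j) powr p)
    = (\<Sum>\<epsilon>\<in>sign_cube n. norm (\<Sum>j=1..n. (real_of_int (\<epsilon> j) * \<bar>a j\<bar>) *\<^sub>R v j) powr p)"
proof -
  define tw :: "(nat \<Rightarrow> int) \<Rightarrow> nat \<Rightarrow> int"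
    where "tw = (\<lambda>\<epsilon>. \<lambda>j\<in>{1..n}. if a j < 0 then - \<epsilon> j else \<epsilon> j)"
  have tw: "tw \<epsilon> \<in> sign_cube n" "tw (tw \<epsilon>) = \<epsilon>" if "\<epsilon> \<in> sign_cube n" for \<epsilon>
    using that by (auto simp: tw_def sign_cube_def PiE_def Pi_def extensional_def fun_eq_iff)
  have "(\<Sum>j=1..n. (real_of_int (tw \<epsilon> j) * \<bar>a j\<bar>) *\<^sub>R v j)
      = (\<Sum>j=1..n. (real_of_int (\<epsilon> j) * a j) *\<^sub>R v j)" for \<epsilon>
    by (intro sum.cong refl) (auto simp: tw_def)
  then show ?thesis
    by (intro sum.reindex_bij_witness[of _ tw tw]) (auto simp: tw)
qed

text \<open>Jensen's inequality over the torus; the mean of \<open>\<bar>triangle_wave h\<bar>\<close> is at least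
  \<open>h / 6 = m / 12\<close>, because \<open>\<bar>t\<bar> \<ge> 2 * t\<^sup>2 / h\<close> on its range.\<close>

lemma triangle_wave_average_le:
  fixes v :: "nat \<Rightarrow> 'a::real_normed_vector"
  assumes h: "0 < h" and m: "m = 2 * h" and p: "1 \<le> p"
  shows "(real m / 12) powr p * real m ^ n * norm (\<Sum>j=1..n. b j *\<^sub>R v j) powr p
    \<le> lp_sum p (torus m n) (\<lambda>x. \<Sum>j=1..n. (b j * \<bar>triangle_wave h (x j)\<bar>) *\<^sub>R v j)"
proof (cases "n = 0")
  case True
  then show ?thesis by simp
next
  case False
  define M where "M = real m ^ n"
  define A where "A = (\<Sum>t\<in>{0..<int m}. \<bar>triangle_wave h t\<bar>)"
  have M: "0 < M" using h m by (simp add: M_def)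
  have coord: "(\<Sum>x\<in>torus m n. \<bar>triangle_wave h (x j)\<bar>) = real m ^ (n - 1) * A" if "j \<in> {1..n}" for j
    unfolding torus_def A_def using that by (subst sum_PiE_coordinate) auto
  \<comment> \<open>With m = 2h one has m * m / 12 = h^2 / 3; one factor \<open>m\<close> comes out
    of \<open>M\<close>, which needs n > 0.\<close>
  have "M * (real m / 12) = real m ^ (n - 1) * (real h ^ 2 / 3)"
    using False by (cases n) (auto simp: M_def m power2_eq_square)
  also have "\<dots> \<le> real m ^ (n - 1) * A"
    using sum_abs_triangle_wave_ge[OF h] by (intro mult_left_mono) (auto simp: A_def m)
  finally have low: "M * (real m / 12) \<le> real m ^ (n - 1) * A" .
  have A: "0 \<le> A" by (simp add: A_def sum_nonneg)
  have "(\<Sum>x\<in>torus m n. \<Sum>j=1..n. (b j * \<bar>triangle_wave h (x j)\<bar>) *\<^sub>R v j)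
      = (\<Sum>j=1..n. (b j * (\<Sum>x\<in>torus m n. \<bar>triangle_wave h (x j)\<bar>)) *\<^sub>R v j)"
    by (subst sum.swap) (simp add: sum_distrib_left scaleR_sum_left)
  also have "\<dots> = (\<Sum>j=1..n. (b j * (real m ^ (n - 1) * A)) *\<^sub>R v j)"
    by (intro sum.cong refl) (simp add: coord)
  also have "\<dots> = (real m ^ (n - 1) * A) *\<^sub>R (\<Sum>j=1..n. b j *\<^sub>R v j)"
    by (simp add: scaleR_sum_right mult.commute)
  finally have total: "norm (\<Sum>x\<in>torus m n. \<Sum>j=1..n. (b j * \<bar>triangle_wave h (x j)\<bar>) *\<^sub>R v j)
      = (real m ^ (n - 1) * A) * norm (\<Sum>j=1..n. b j *\<^sub>R v j)"
    using A by simp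
  have "(M * (real m / 12)) powr p * norm (\<Sum>j=1..n. b j *\<^sub>R v j) powr p
      \<le> (real m ^ (n - 1) * A) powr p * norm (\<Sum>j=1..n. b j *\<^sub>R v j) powr p"
    using low M p by (intro mult_right_mono powr_mono2) auto
  also have "\<dots> = norm (\<Sum>x\<in>torus m n. \<Sum>j=1..n. (b j * \<bar>triangle_wave h (x j)\<bar>) *\<^sub>R v j) powr p"
    unfolding total using A by (simp add: powr_mult)
  \<comment> \<open>Jensen's inequality over the \<open>M\<close> points of the torus.\<close>
  also have "\<dots> \<le> M powr (p - 1) *
      lp_sum p (torus m n) (\<lambda>x. \<Sum>j=1..n. (b j * \<bar>triangle_wave h (x j)\<bar>) *\<^sub>R v j)"
    unfolding lp_sum_def M_def of_nat_power[symmetric] card_torus[symmetric]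
    by (rule norm_sum_powr_le[OF finite_torus p])
  finally have *: "(M * (real m / 12)) powr p * norm (\<Sum>j=1..n. b j *\<^sub>R v j) powr p
      \<le> M powr (p - 1) *
        lp_sum p (torus m n) (\<lambda>x. \<Sum>j=1..n. (b j * \<bar>triangle_wave h (x j)\<bar>) *\<^sub>R v j)" .
  have "M powr (p - 1) * ((real m / 12) powr p * M * norm (\<Sum>j=1..n. b j *\<^sub>R v j) powr p)
      \<le> M powr (p - 1) *
        lp_sum p (torus m n) (\<lambda>x. \<Sum>j=1..n. (b j * \<bar>triangle_wave h (x j)\<bar>) *\<^sub>R v j)"
  proof -
    have "(M * (real m / 12)) powr p = M powr (p - 1) * ((real m / 12) powr p * M)"
      using M by (subst powr_mult) (simp_all add: powr_diff)
    with * show ?thesis by (simp only: mult.assoc)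
  qed
  then show ?thesis using M by (simp add: M_def)
qed

text \<open>The antipodal increment gains a factor 2, the mean of the wave loses at most m/12, and
  \<open>m\<close> cancels against the \<open>m\<close> of the scaled inequality: 12/2 = 6.\<close>

lemma scaled_enflo_imp_rademacher:
  assumes E: "scaled_enflo_type_with TYPE('a::banach) p \<tau>" and p: "1 \<le> p"
  shows "rademacher_type_with TYPE('a) p (6 * \<tau>)"
proof -
  have tau: "0 \<le> \<tau>" using E by (simp add: scaled_enflo_type_with_def)
  have "(\<Sum>\<epsilon>\<in>sign_cube n. norm (\<Sum>j=1..n. real_of_int (\<epsilon> j) *\<^sub>R v j) powr p) / 2 ^ n
      \<le> (6 * \<tau>) powr p * (\<Sum>j=1..n. norm (v j) powr p)" for n and v :: "nat \<Rightarrow> 'a"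
  \<comment> \<open>Scaled Enflo type speaks of positive \<open>n\<close> only; for n = 0 both sides
    vanish.\<close>
  proof (cases "n = 0")
    case True
    then show ?thesis by simp
  next
    case False
    then obtain m where m: "0 < m" "even m" and ineq: "\<And>f :: (nat \<Rightarrow> int) \<Rightarrow> 'a.
        uniform_expectation (sign_cube n) (\<lambda>\<epsilon>. uniform_expectation (torus m n) (\<lambda>x.
          dist (f (torus_add m n x (\<lambda>i. int (m div 2) * \<epsilon> i))) (f x) powr p))
        \<le> \<tau> powr p * real m powr p * (\<Sum>j=1..n. uniform_expectation (torus m n) (\<lambda>x.
            dist (f (torus_add m n x (std_basis j))) (f x) powr p))"
      using E unfolding scaled_enflo_type_with_def by blast
    define h where "h = m div 2"
    have mh: "m = 2 * h" and h: "0 < h" using m by (auto simp: h_def)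
    let ?P = "lp_sum p (torus m n)"
    define V where "V = (\<Sum>j=1..n. norm (v j) powr p)"
    define S where "S = (\<lambda>x. \<Sum>j=1..n. triangle_wave h (x j) *\<^sub>R v j)"
    have S: "periodic m n S"
      unfolding periodic_def S_def mh by (auto simp: wrap_def intro!: sum.cong)
    then have S_wrap: "S (wrap m n z) = S z" for z by (simp add: periodic_def)
    have antipode: "?P (\<lambda>x. S (x + (\<lambda>i. int h * \<epsilon> i)) - S x) = 2 powr p * ?P S"
      if e: "\<epsilon> \<in> sign_cube n" for \<epsilon>
    proof -
      have "S (x + (\<lambda>i. int h * \<epsilon> i)) = - S x" for x
        unfolding S_def sum_negf[symmetric]
        by (intro sum.cong refl) (simp add: triangle_wave_sign_shift[OF h sign_cubeD[OF e]])
      moreover have "- u - u = (-2) *\<^sub>R u" for u :: 'a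
        using scaleR_add_left[of "-1" "-1" u] by simp
      ultimately have "S (x + (\<lambda>i. int h * \<epsilon> i)) - S x = (-2) *\<^sub>R S x" for x
        by (simp only:)
      then have "?P (\<lambda>x. S (x + (\<lambda>i. int h * \<epsilon> i)) - S x) = ?P (\<lambda>x. (-2) *\<^sub>R S x)"
        by simp
      then show ?thesis by (simp only: lp_sum_scaleR) simp
    qed
    have edge: "?P (\<lambda>x. S (x + std_basis j) - S x) \<le> real m ^ n * norm (v j) powr p"
      if j: "j \<in> {1..n}" for j
    proof -
      have "norm (S (x + std_basis j) - S x) \<le> norm (v j)" for x
      proof -
        have "S (x + std_basis j) - S x
            = (\<Sum>i=1..n. if i = j then (triangle_wave h (x j + 1) - triangle_wave h (x j)) *\<^sub>R v j else 0)"
          unfolding S_def sum_subtractf[symmetric]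
          by (intro sum.cong refl) (auto simp: std_basis_def scaleR_diff_left)
        also have "\<dots> = (triangle_wave h (x j + 1) - triangle_wave h (x j)) *\<^sub>R v j"
          using j by simp
        finally show ?thesis
          using mult_right_mono[OF triangle_wave_lipschitz[OF h, of "x j"], of "norm (v j)"] by simp
      qed
      then have "?P (\<lambda>x. S (x + std_basis j) - S x) \<le> (\<Sum>x\<in>torus m n. norm (v j) powr p)"
        unfolding lp_sum_def using p by (intro sum_mono powr_mono2) auto
      then show ?thesis by (simp add: card_torus)
    qed
    have upper: "2 powr p * ?P S \<le> \<tau> powr p * real m powr p * (real m ^ n * V)"
    proof -
      have "2 powr p * ?P S / real m ^ n
          = (\<Sum>\<epsilon>\<in>sign_cube n. ?P (\<lambda>x. S (x + (\<lambda>i. int h * \<epsilon> i)) - S x) / real m ^ n) / 2 ^ n"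
        by (simp add: antipode card_sign_cube)
      also have "\<dots> \<le> \<tau> powr p * real m powr p *
          (\<Sum>j=1..n. ?P (\<lambda>x. S (x + std_basis j) - S x) / real m ^ n)"
        using ineq[of S] unfolding uniform_expectation_increment[OF m(1)]
          uniform_expectation_sign_cube S_wrap h_def .
      also have "\<dots> \<le> \<tau> powr p * real m powr p * (\<Sum>j=1..n. norm (v j) powr p)"
        using edge m by (intro mult_left_mono sum_mono) (auto simp: divide_le_eq mult.commute)
      finally show ?thesis using m by (simp add: V_def divide_le_eq mult_ac)
    qed
    have sign_flip: "?P S = ?P (\<lambda>x. \<Sum>j=1..n. (real_of_int (\<epsilon> j) * triangle_wave h (x j)) *\<^sub>R v j)"
      if e: "\<epsilon> \<in> sign_cube n" for \<epsilon>
    proof -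
      \<comment> \<open>Moving the coordinates with \<epsilon> i = -1 by half a period flips exactly
        those signs, and translations preserve \<open>?P\<close>.\<close>
      define y where "y = (\<lambda>i. if \<epsilon> i = 1 then 0 else int h)"
      have "S (x + y) = (\<Sum>j=1..n. (real_of_int (\<epsilon> j) * triangle_wave h (x j)) *\<^sub>R v j)" for x
        unfolding S_def
      proof (intro sum.cong refl)
        fix j assume "j \<in> {1..n}"
        from sign_cubeD[OF e this]
        show "triangle_wave h ((x + y) j) *\<^sub>R v j = (real_of_int (\<epsilon> j) * triangle_wave h (x j)) *\<^sub>R v j"
          by (auto simp: y_def triangle_wave_antiperiodic[OF h])
      qed
      then show ?thesis using lp_sum_shift[OF m(1) S, of p y] by simp
    qed
    have swap: "(\<Sum>\<epsilon>\<in>sign_cube n. ?P (G \<epsilon>)) = (\<Sum>x\<in>torus m n. \<Sum>\<epsilon>\<in>sign_cube n. norm (G \<epsilon> x) powr p)"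
      for G :: "(nat \<Rightarrow> int) \<Rightarrow> (nat \<Rightarrow> int) \<Rightarrow> 'a"
      unfolding lp_sum_def by (rule sum.swap)
    have "(real m / 12) powr p * real m ^ n *
        (\<Sum>\<epsilon>\<in>sign_cube n. norm (\<Sum>j=1..n. real_of_int (\<epsilon> j) *\<^sub>R v j) powr p)
      \<le> (\<Sum>\<epsilon>\<in>sign_cube n. ?P (\<lambda>x. \<Sum>j=1..n. (real_of_int (\<epsilon> j) * \<bar>triangle_wave h (x j)\<bar>) *\<^sub>R v j))"
      unfolding sum_distrib_left by (intro sum_mono triangle_wave_average_le[OF h mh p])
    \<comment> \<open>For each fixed \<open>x\<close> the signs of the wave values are absorbed into
      \<epsilon>.\<close>
    also have "\<dots> = (\<Sum>\<epsilon>\<in>sign_cube n. ?P (\<lambda>x. \<Sum>j=1..n. (real_of_int (\<epsilon> j) * triangle_wave h (x j)) *\<^sub>R v j))"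
      unfolding swap by (rule sum.cong[OF refl sum_sign_cube_twist[symmetric]])
    also have "\<dots> = (\<Sum>\<epsilon>\<in>sign_cube n. ?P S)"
      by (intro sum.cong refl sign_flip[symmetric])
    also have "\<dots> = 2 ^ n * ?P S"
      by (simp add: card_sign_cube)
    finally have "2 powr p * ((real m / 12) powr p * real m ^ n *
        (\<Sum>\<epsilon>\<in>sign_cube n. norm (\<Sum>j=1..n. real_of_int (\<epsilon> j) *\<^sub>R v j) powr p))
      \<le> 2 powr p * (2 ^ n * ?P S)"
      by (rule mult_left_mono) auto
    also have "\<dots> \<le> 2 ^ n * (\<tau> powr p * real m powr p * (real m ^ n * V))"
      using upper by (simp add: mult_ac)
    also have "\<dots> = (2 powr p * (real m / 12) powr p * real m ^ n) * (2 ^ n * ((6 * \<tau>) powr p * V))"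
    proof -
      have "\<tau> powr p * real m powr p = 2 powr p * (real m / 12) powr p * (6 * \<tau>) powr p"
        using tau by (simp flip: powr_mult) (simp add: mult_ac)
      then show ?thesis by (simp add: mult_ac)
    qed
    finally have "(2 powr p * (real m / 12) powr p * real m ^ n) *
        (\<Sum>\<epsilon>\<in>sign_cube n. norm (\<Sum>j=1..n. real_of_int (\<epsilon> j) *\<^sub>R v j) powr p)
      \<le> (2 powr p * (real m / 12) powr p * real m ^ n) * (2 ^ n * ((6 * \<tau>) powr p * V))"
      by (simp add: mult_ac)
    then show ?thesis
      using m by (simp add: V_def divide_le_eq mult_ac)
  qed
  then show ?thesis
    using tau unfolding rademacher_type_with_def uniform_expectation_sign_cube by simp
qed

section \<open>Comparison of the two constants as extended reals\<close>

theorem theorem1p2: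
  fixes p :: real
  assumes "1 \<le> p" and "p \<le> 2"
  shows "(rademacher_type TYPE('a::banach) p \<longleftrightarrow> scaled_enflo_type TYPE('a) p)
    \<and> ereal (1 / (2 * pi)) * rademacher_type_const TYPE('a) p \<le> scaled_enflo_type_const TYPE('a) p
    \<and> scaled_enflo_type_const TYPE('a) p \<le> 5 * rademacher_type_const TYPE('a) p"
proof (intro conjI)
  let ?R = "rademacher_type_const TYPE('a) p"
  let ?E = "scaled_enflo_type_const TYPE('a) p"
  note RE = rademacher_imp_scaled_enflo[OF _ assms(1), where 'a = 'a]
  note ER = scaled_enflo_imp_rademacher[OF _ assms(1), where 'a = 'a]
  show "rademacher_type TYPE('a) p \<longleftrightarrow> scaled_enflo_type TYPE('a) p"
    unfolding rademacher_type_def scaled_enflo_type_def using RE ER by blast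
  show "ereal (1 / (2 * pi)) * ?R \<le> ?E"
    unfolding scaled_enflo_type_const_def
  proof (rule INF_greatest)
    fix \<tau> assume "\<tau> \<in> {\<tau>. scaled_enflo_type_with TYPE('a) p \<tau>}"
    then have E: "scaled_enflo_type_with TYPE('a) p \<tau>" by simp
    then have tau: "0 \<le> \<tau>" by (simp add: scaled_enflo_type_with_def)
    have "?R \<le> ereal (6 * \<tau>)"
      unfolding rademacher_type_const_def using ER[OF E] by (intro INF_lower) simp
    then have "ereal (1 / (2 * pi)) * ?R \<le> ereal (1 / (2 * pi)) * ereal (6 * \<tau>)"
      by (intro ereal_mult_left_mono) auto
    \<comment> \<open>This amounts to 6 <= 2 pi.\<close>
    also have "\<dots> \<le> ereal \<tau>"
      using mult_right_mono[OF less_imp_le[OF pi_gt3] tau] by (simp add: divide_le_eq mult.commute)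
    finally show "ereal (1 / (2 * pi)) * ?R \<le> ereal \<tau>" .
  qed
  \<comment> \<open>The constant is moved to the left so that \<open>?R\<close> can be treated as a
    greatest lower bound; multiplying back by 5 is valid for infinite values too.\<close>
  have "ereal (1 / 5) * ?E \<le> ?R"
    unfolding rademacher_type_const_def
  proof (rule INF_greatest)
    fix T assume "T \<in> {T. rademacher_type_with TYPE('a) p T}"
    then have "?E \<le> ereal (5 * T)"
      unfolding scaled_enflo_type_const_def using RE by (intro INF_lower) simp
    then have "ereal (1 / 5) * ?E \<le> ereal (1 / 5) * ereal (5 * T)"
      by (intro ereal_mult_left_mono) auto
    then show "ereal (1 / 5) * ?E \<le> ereal T" by simp
  qed
  then have "ereal 5 * (ereal (1 / 5) * ?E) \<le> ereal 5 * ?R"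
    by (intro ereal_mult_left_mono) auto
  moreover have "ereal 5 * ereal (1 / 5) = 1"
    by (simp only: times_ereal.simps) simp
  ultimately show "?E \<le> 5 * ?R" by (metis mult.assoc mult_1 numeral_eq_ereal)
qed

end
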